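(* Let $s\ge1$ and let $(\Gamma,\mathbf k)$ be a connected, $\mathbf Z/2^s$-reduced negative color scheme. Let $\Gamma'=\mathrm{Red}_{2^{s-1}}(\Gamma,\mathbf k)$. (1) If $(\Gamma,\mathbf k)$ is $\mathbf Z/2^s$-oriented, then either $\Gamma$ is bipartite, or $\Gamma$ is not bipartite but $\Gamma'$ is bipartite and $\mathrm{val}_2(\mathrm{GCD}(\mathbf k))=0$. (2) If $\Gamma$ is bipartite, with bipartitioning $\alpha$ of $\Gamma$, then the divided fundamental class $\sum_{v}\alpha(v)\frac{k_v}{\mathrm{GCD}(\mathbf k)}v$ is a $\mathbf Z/2^s$-orientation class of $(\Gamma,\mathbf k)$. (3) If $\Gamma'$ is bipartite and $\mathrm{val}_2(\mathrm{GCD}(\mathbf k))=0$, then for each bipartitioning $\alpha$ of $\Gamma'$ the divided fundamental class $\sum_{v}\alpha(v)\frac{k_v}{\mathrm{GCD}(\mathbf k)}v$ is a $\mathbf Z/2^s$-orientation class of $(\Gamma,\mathbf k)$.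
   Context: Graphs are finite, without loops or multiple edges; $e(v,w)$ denotes the edge joining $v,w$. A negative color scheme $(\Gamma,\mathbf k)$ is a graph $\Gamma$ with a positive integer $k_v$ for each vertex $v$. Its cochain complex $C^*(\Gamma,\mathbf k)$ has $C^0=\mathbf Z[V(\Gamma)]$, $C^1=\mathbf Z[E(\Gamma)]$, $d^0(v)=\sum_{w} k_w\, e(v,w)$ (sum over neighbours $w$ of $v$). $H^*(\Gamma,\mathbf k;R)$ is the cohomology of $C^*(\Gamma,\mathbf k)\otimes R$; $H^0(\Gamma,\mathbf k;R)\subset C^0(\Gamma,\mathbf k;R)$ is the group of cocycles. $\mathbf Z/2^s$-reduced: there is no edge $e(v,w)$ with $k_vk_w=0$ in $\mathbf Z/2^s$. $\mathrm{Red}_{2^{t}}(\Gamma,\mathbf k)$ is obtained from $\Gamma$ by removing all edges $e(v,w)$ with $\mathrm{val}_2(k_vk_w)\ge t$ (keeping all vertices and weights). It need not be connected. Let $i:\mathbf Z/2^{s-1}\to\mathbf Z/2^s$ be $i(x)=2x$. The critical cohomology $\mathcal{CR}(\Gamma,\mathbf k;\mathbf Z/2^s)$ is the cokernel of $i_*:H^0(\Gamma,\mathbf k;\mathbf Z/2^{s-1})\to H^0(\Gamma,\mathbf k;\mathbf Z/2^s)$. A connected $(\Gamma,\mathbf k)$ is $\mathbf Z/2^s$-oriented if $\mathcal{CR}(\Gamma,\mathbf k;\mathbf Z/2^s)\cong\mathbf Z/2$; a $\mathbf Z/2^s$-orientation class is then an element of $H^0(\Gamma,\mathbf k;\mathbf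 Z/2^s)$ mapping to a generator of this cokernel. Integral cochains are considered modulo $2^s$ where relevant. A bipartitioning of a graph is a map $\alpha$ from its vertices to $\{\pm1\}$ taking different values at the endpoints of every edge; a (not necessarily connected) graph is bipartite if one exists. $\mathrm{GCD}(\mathbf k)$ is the greatest common divisor of all the $k_v$; $\mathrm{val}_2$ is the 2-adic valuation. *)

theory Defs
  imports "HOL-Algebra.Algebra" "HOL-Number_Theory.Number_Theory"
begin

text \<open>A graph is given by its vertex set \<open>V\<close> and its set \<open>E\<close> of edges, the edge joining
  \<open>v\<close> and \<open>w\<close> being the two-element set \<open>{v, w}\<close>.\<close>

definition simple_graph :: "'v set \<Rightarrow> 'v set set \<Rightarrow> bool" where
  "simple_graph V E \<longleftrightarrow> finite V \<and> (\<forall>e\<in>E. e \<subseteq> V \<and> card e = 2)"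

text \<open>The empty graph is not connected.\<close>

definition connected_graph :: "'v set \<Rightarrow> 'v set set \<Rightarrow> bool" where
  "connected_graph V E \<longleftrightarrow>
     V \<noteq> {} \<and> (\<forall>v\<in>V. \<forall>w\<in>V. (v, w) \<in> {(x, y). {x, y} \<in> E}\<^sup>*)"

definition bipartitioning :: "'v set \<Rightarrow> 'v set set \<Rightarrow> ('v \<Rightarrow> int) \<Rightarrow> bool" where
  "bipartitioning V E \<alpha> \<longleftrightarrow>
     (\<forall>v\<in>V. \<alpha> v \<in> {1, -1}) \<and> (\<forall>v w. {v, w} \<in> E \<longrightarrow> \<alpha> v \<noteq> \<alpha> w)"

definition bipartite :: "'v set \<Rightarrow> 'v set set \<Rightarrow> bool" where
  "bipartite V E \<longleftrightarrow> (\<exists>\<alpha>. bipartitioning V E \<alpha>)"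

definition negative_color_scheme :: "'v set \<Rightarrow> 'v set set \<Rightarrow> ('v \<Rightarrow> nat) \<Rightarrow> bool" where
  "negative_color_scheme V E k \<longleftrightarrow> simple_graph V E \<and> (\<forall>v\<in>V. k v > 0)"

definition zmod_reduced :: "nat \<Rightarrow> 'v set set \<Rightarrow> ('v \<Rightarrow> nat) \<Rightarrow> bool" where
  "zmod_reduced n E k \<longleftrightarrow> \<not> (\<exists>v w. {v, w} \<in> E \<and> [k v * k w = 0] (mod n))"

text \<open>The edge set of \<open>Red\<close> for the modulus \<open>2 ^ t\<close>; vertices and weights are unchanged.\<close>

definition red_edges :: "nat \<Rightarrow> 'v set set \<Rightarrow> ('v \<Rightarrow> nat) \<Rightarrow> 'v set set" where
  "red_edges t E k = E - {{v, w} | v w. {v, w} \<in> E \<and> multiplicity 2 (k v * k w) \<ge> t}"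

text \<open>The coefficient of \<open>e\<close> in \<open>d\<^sup>0 v = (\<Sum>w. k w \<cdot> e(v, w)) \<in> \<int>[E]\<close>, where \<open>w\<close> ranges over
  the neighbours of \<open>v\<close>.\<close>

definition d0_coeff :: "'v set set \<Rightarrow> ('v \<Rightarrow> nat) \<Rightarrow> 'v \<Rightarrow> 'v set \<Rightarrow> int" where
  "d0_coeff E k v e = (\<Sum>w | {v, w} \<in> E. if e = {v, w} then int (k w) else 0)"

text \<open>Coefficient groups \<open>A\<close> are abelian groups in the multiplicative notation of
  \<^theory>\<open>HOL-Algebra.Group\<close>, so the integer \<open>n\<close> acts on \<open>a\<close> as \<open>a [^] n\<close>, and the tensor product of
  \<open>\<int>[V]\<close> with \<open>A\<close> is the group of functions from \<open>V\<close> to \<open>A\<close>, since \<open>V\<close> is finite. The map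
  \<open>d0\<close> is \<open>d\<^sup>0 \<otimes> A\<close>. For \<open>A = \<close> \<^term>\<open>integer_mod_group n\<close> the elements are the
  representatives \<open>0, \<dots>, n - 1\<close> of the residue classes modulo \<open>n\<close>, also when \<open>n = 1\<close>.\<close>

definition C0 :: "'v set \<Rightarrow> ('a, 'b) monoid_scheme \<Rightarrow> ('v \<Rightarrow> 'a) monoid" where
  "C0 V A = product_group V (\<lambda>_. A)"

definition C1 :: "'v set set \<Rightarrow> ('a, 'b) monoid_scheme \<Rightarrow> ('v set \<Rightarrow> 'a) monoid" where
  "C1 E A = product_group E (\<lambda>_. A)"

definition d0 :: "'v set \<Rightarrow> 'v set set \<Rightarrow> ('v \<Rightarrow> nat) \<Rightarrow> ('a, 'b) monoid_scheme
    \<Rightarrow> ('v \<Rightarrow> 'a) \<Rightarrow> ('v set \<Rightarrow> 'a)" where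
  "d0 V E k A c = (\<lambda>e\<in>E. finprod A (\<lambda>v. c v [^]\<^bsub>A\<^esub> d0_coeff E k v e) V)"

definition H0 :: "'v set \<Rightarrow> 'v set set \<Rightarrow> ('v \<Rightarrow> nat) \<Rightarrow> ('a, 'b) monoid_scheme
    \<Rightarrow> ('v \<Rightarrow> 'a) monoid" where
  "H0 V E k A = (C0 V A)\<lparr>carrier := kernel (C0 V A) (C1 E A) (d0 V E k A)\<rparr>"

text \<open>On representatives, \<open>i(x) = 2x\<close> maps \<open>{0..<2 ^ (s - 1)}\<close> into \<open>{0..<2 ^ s}\<close>.
  All notions below are used for \<open>s \<ge> 1\<close> only.\<close>

definition i_star :: "'v set \<Rightarrow> ('v \<Rightarrow> int) \<Rightarrow> ('v \<Rightarrow> int)" where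
  "i_star V c = (\<lambda>v\<in>V. 2 * c v)"

definition i_image :: "nat \<Rightarrow> 'v set \<Rightarrow> 'v set set \<Rightarrow> ('v \<Rightarrow> nat) \<Rightarrow> ('v \<Rightarrow> int) set" where
  "i_image s V E k = i_star V ` carrier (H0 V E k (integer_mod_group (2 ^ (s - 1))))"

definition critical_cohomology :: "nat \<Rightarrow> 'v set \<Rightarrow> 'v set set \<Rightarrow> ('v \<Rightarrow> nat)
    \<Rightarrow> ('v \<Rightarrow> int) set monoid" where
  "critical_cohomology s V E k = H0 V E k (integer_mod_group (2 ^ s)) Mod i_image s V E k"

definition oriented :: "nat \<Rightarrow> 'v set \<Rightarrow> 'v set set \<Rightarrow> ('v \<Rightarrow> nat) \<Rightarrow> bool" where
  "oriented s V E k \<longleftrightarrow>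
     connected_graph V E \<and> critical_cohomology s V E k \<cong> integer_mod_group 2"

definition orientation_class :: "nat \<Rightarrow> 'v set \<Rightarrow> 'v set set \<Rightarrow> ('v \<Rightarrow> nat)
    \<Rightarrow> ('v \<Rightarrow> int) \<Rightarrow> bool" where
  "orientation_class s V E k c \<longleftrightarrow>
     oriented s V E k \<and>
     c \<in> carrier (H0 V E k (integer_mod_group (2 ^ s))) \<and>
     generate (critical_cohomology s V E k)
       {i_image s V E k #>\<^bsub>H0 V E k (integer_mod_group (2 ^ s))\<^esub> c}
     = carrier (critical_cohomology s V E k)"

text \<open>The division by the greatest common divisor is exact.\<close>

definition divided_fundamental_class :: "'v set \<Rightarrow> ('v \<Rightarrow> nat) \<Rightarrow> ('v \<Rightarrow> int) \<Rightarrow> ('v \<Rightarrow> int)" where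
  "divided_fundamental_class V k \<alpha> = (\<lambda>v\<in>V. \<alpha> v * int (k v div (GCD u\<in>V. k u)))"

definition reduce_mod :: "nat \<Rightarrow> 'v set \<Rightarrow> ('v \<Rightarrow> int) \<Rightarrow> ('v \<Rightarrow> int)" where
  "reduce_mod n V c = (\<lambda>v\<in>V. c v mod int n)"

end

theory Submission
  imports Defs
begin

text \<open>A cocycle modulo \<open>2 ^ s\<close> is a function \<open>c\<close> with \<open>c v * k w + c w * k v = 0\<close> modulo \<open>2 ^ s\<close> on
  every edge \<open>{v, w}\<close>. The image of \<open>i\<close> consists of the cocycles with only even values
  (\<open>i_image_eq_even_cocycles\<close>), so the critical cohomology is the set of parity patterns of cocycles.

  On a reduced connected scheme, one odd value of \<open>c\<close> fixes the 2-adic valuation of all values: up to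
  a constant it is that of \<open>k\<close> (\<open>odd_cocycle_values\<close>). Therefore the only possible nonzero parity
  pattern is the indicator function of the vertices where the valuation of \<open>k\<close> is minimal. It follows
  that the scheme is oriented if and only if some cocycle has an odd value, and that the orientation
  classes are exactly these cocycles (\<open>odd_cocycle_orientation_class\<close>, \<open>oriented_imp_odd_cocycle\<close>).

  The divided fundamental class always has an odd value. Its coboundary vanishes on edges with
  opposite signs, and on an edge with equal signs it is \<open>2 * k v * k w / GCD k\<close> up to sign, which is
  zero modulo \<open>2 ^ s\<close> when the edge is deleted in the reduction and the greatest common divisor is
  odd. This gives both existence statements.

  Conversely, dividing the values of an odd cocycle and of \<open>k\<close> by their powers of 2 turns the cocycle
  condition into a congruence between odd numbers. As soon as this congruence holds modulo 4, it says
  that the two endpoints carry opposite signs modulo 4 (\<open>odd_cocycle_bipartite\<close>). It holds modulo 4 on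
  all edges if the greatest common divisor is even, and on the edges of the reduction otherwise.\<close>

section \<open>Cocycles as congruences on edges\<close>

lemma edge_endpoints:
  assumes "simple_graph V E" "{v, w} \<in> E"
  shows "v \<in> V" "w \<in> V" "v \<noteq> w"
proof -
  have "{v, w} \<subseteq> V" "card {v, w} = 2"
    using assms by (auto simp: simple_graph_def)
  then show "v \<in> V" "w \<in> V" "v \<noteq> w" by auto
qed

lemma edge_obtain:
  assumes "simple_graph V E" "e \<in> E"
  obtains v w where "e = {v, w}"
  using assms by (auto simp: simple_graph_def card_2_iff)

lemma d0_coeff_edge:
  assumes "simple_graph V E" "{a, b} \<in> E" "v \<in> V"
  shows "d0_coeff E k v {a, b} = (if v = a then int (k b) else if v = b then int (k a) else 0)"
proof -
  have fin: "finite {w. {v, w} \<in> E}"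
    by (rule finite_subset[of _ V])
      (use assms(1) in \<open>auto simp: simple_graph_def\<close>)
  have ab: "a \<noteq> b" using edge_endpoints[OF assms(1,2)] by simp
  have ba: "{b, a} \<in> E" using assms(2) by (simp add: insert_commute)
  consider "v = a" | "v = b" "v \<noteq> a" | "v \<noteq> a" "v \<noteq> b" by blast
  then show ?thesis
  proof cases
    case 1
    have "d0_coeff E k v {a, b} = (\<Sum>w | {v, w} \<in> E. if w = b then int (k w) else 0)"
      unfolding d0_coeff_def using ab 1 by (intro sum.cong) (auto simp: doubleton_eq_iff)
    then show ?thesis using fin assms(2) 1 by simp
  next
    case 2
    have "d0_coeff E k v {a, b} = (\<Sum>w | {v, w} \<in> E. if w = a then int (k w) else 0)"
      unfolding d0_coeff_def using ab 2 by (intro sum.cong) (auto simp: doubleton_eq_iff)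
    then show ?thesis using fin ba 2 by simp
  next
    case 3
    then have "d0_coeff E k v {a, b} = (\<Sum>w | {v, w} \<in> E. 0)"
      unfolding d0_coeff_def by (intro sum.cong) (auto simp: doubleton_eq_iff)
    then show ?thesis using 3 by simp
  qed
qed

lemma finprod_integer_mod_group:
  assumes "finite V" "\<And>v. v \<in> V \<Longrightarrow> f v \<in> carrier (integer_mod_group n)"
  shows "finprod (integer_mod_group n) f V = (\<Sum>v\<in>V. f v) mod int n"
proof -
  interpret comm_group "integer_mod_group n" by simp
  show ?thesis
    using assms by (induction V rule: finite_induct) (auto simp: Pi_def mod_add_right_eq)
qed

lemma d0_integer_mod_group:
  assumes "simple_graph V E" "e \<in> E"
  shows "d0 V E k (integer_mod_group n) c e = (\<Sum>v\<in>V. d0_coeff E k v e * c v) mod int n"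
proof -
  have "finite V" using assms(1) by (simp add: simple_graph_def)
  have "d0 V E k (integer_mod_group n) c e
      = finprod (integer_mod_group n) (\<lambda>v. (d0_coeff E k v e * c v) mod int n) V"
    using assms(2) by (simp add: d0_def int_pow_integer_mod_group)
  also have "\<dots> = (\<Sum>v\<in>V. (d0_coeff E k v e * c v) mod int n) mod int n"
    by (intro finprod_integer_mod_group \<open>finite V\<close>) (simp add: carrier_integer_mod_group)
  finally show ?thesis by (simp add: mod_sum_eq)
qed

lemma d0_integer_mod_group_edge:
  assumes "simple_graph V E" "{a, b} \<in> E"
  shows "d0 V E k (integer_mod_group n) c {a, b} = (c a * int (k b) + c b * int (k a)) mod int n"
proof -
  have fin: "finite V" using assms(1) by (simp add: simple_graph_def)
  note ab = edge_endpoints[OF assms]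
  have "(\<Sum>v\<in>V. d0_coeff E k v {a, b} * c v)
      = (\<Sum>v\<in>V. (if v = a then c v * int (k b) else 0) + (if v = b then c v * int (k a) else 0))"
    using ab by (intro sum.cong) (auto simp: d0_coeff_edge[OF assms])
  also have "\<dots> = c a * int (k b) + c b * int (k a)"
    using fin ab by (simp add: sum.distrib)
  finally show ?thesis by (simp add: d0_integer_mod_group[OF assms])
qed

lemma group_hom_d0:
  assumes "simple_graph V E"
  shows "group_hom (C0 V (integer_mod_group n)) (C1 E (integer_mod_group n))
           (d0 V E k (integer_mod_group n))"
proof -
  let ?A = "integer_mod_group n"
  have "d0 V E k ?A \<in> hom (C0 V ?A) (C1 E ?A)"
  proof (rule homI)
    fix c
    show "d0 V E k ?A c \<in> carrier (C1 E ?A)"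
    proof -
      have "d0 V E k ?A c e \<in> carrier ?A" if "e \<in> E" for e
        using that by (simp add: d0_integer_mod_group[OF assms] carrier_integer_mod_group)
      moreover have "d0 V E k ?A c \<in> extensional E" by (simp add: d0_def)
      ultimately show ?thesis by (auto simp: C1_def PiE_def)
    qed
  next
    fix c c'
    show "d0 V E k ?A (c \<otimes>\<^bsub>C0 V ?A\<^esub> c') = d0 V E k ?A c \<otimes>\<^bsub>C1 E ?A\<^esub> d0 V E k ?A c'" (is "?l = ?r")
    proof
      fix e
      show "?l e = ?r e"
      proof (cases "e \<in> E")
        case True
        then obtain a b where e: "e = {a, b}" using edge_obtain[OF assms] by blast
        then have ab: "{a, b} \<in> E" using True by simp
        have "a \<in> V" "b \<in> V" using edge_endpoints[OF assms ab] by auto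
        then have "?l e = ((c a + c' a) mod int n * int (k b)
            + (c b + c' b) mod int n * int (k a)) mod int n"
          unfolding e d0_integer_mod_group_edge[OF assms ab] by (simp add: C0_def)
        also have "\<dots> = ((c a + c' a) * int (k b) + (c b + c' b) * int (k a)) mod int n"
          by (intro mod_add_cong mod_mult_cong) simp_all
        also have "\<dots> = ((c a * int (k b) + c b * int (k a)) mod int n
            + (c' a * int (k b) + c' b * int (k a)) mod int n) mod int n"
          unfolding mod_add_eq by (simp add: algebra_simps)
        also have "\<dots> = ?r e"
          using ab by (simp add: e C1_def d0_integer_mod_group_edge[OF assms ab])
        finally show ?thesis .
      qed (simp add: d0_def C1_def)
    qed
  qed
  then show ?thesis
    by (intro group_hom.intro group_hom_axioms.intro) (simp_all add: C0_def C1_def)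
qed

lemma group_H0:
  assumes "simple_graph V E"
  shows "group (H0 V E k (integer_mod_group n))"
proof -
  interpret group_hom "C0 V (integer_mod_group n)" "C1 E (integer_mod_group n)"
      "d0 V E k (integer_mod_group n)"
    by (rule group_hom_d0[OF assms])
  show ?thesis unfolding H0_def by (rule G.subgroup_imp_group[OF subgroup_kernel])
qed

lemma mult_H0:
  "c \<otimes>\<^bsub>H0 V E k (integer_mod_group n)\<^esub> c' = (\<lambda>v\<in>V. (c v + c' v) mod int n)"
  by (simp add: H0_def C0_def)

lemma carrier_H0_iff:
  assumes "simple_graph V E" "n > 0"
  shows "c \<in> carrier (H0 V E k (integer_mod_group n)) \<longleftrightarrow>
    c \<in> V \<rightarrow>\<^sub>E {0..<int n} \<and> (\<forall>v w. {v, w} \<in> E \<longrightarrow> int n dvd c v * int (k w) + c w * int (k v))"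
proof -
  let ?A = "integer_mod_group n"
  have "d0 V E k ?A c = \<one>\<^bsub>C1 E ?A\<^esub> \<longleftrightarrow> (\<forall>e\<in>E. d0 V E k ?A c e = 0)"
    by (auto simp: C1_def fun_eq_iff d0_def restrict_def)
  also have "\<dots> \<longleftrightarrow> (\<forall>v w. {v, w} \<in> E \<longrightarrow> d0 V E k ?A c {v, w} = 0)"
    using edge_obtain[OF assms(1)] by metis
  also have "\<dots> \<longleftrightarrow> (\<forall>v w. {v, w} \<in> E \<longrightarrow> int n dvd c v * int (k w) + c w * int (k v))"
    using d0_integer_mod_group_edge[OF assms(1)] by (auto simp: dvd_eq_mod_eq_0)
  finally show ?thesis
    using assms(2) by (simp add: H0_def kernel_def C0_def carrier_integer_mod_group)
qed

text \<open>The elements of the cochain groups are least nonnegative representatives, so an integral cochain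
  has to be reduced before it can be a cocycle.\<close>

lemma reduce_mod_in_carrier_H0:
  assumes "simple_graph V E" "n > 0"
    and "\<And>v w. {v, w} \<in> E \<Longrightarrow> int n dvd c v * int (k w) + c w * int (k v)"
  shows "reduce_mod n V c \<in> carrier (H0 V E k (integer_mod_group n))"
proof -
  have "int n dvd (c v mod int n) * int (k w) + (c w mod int n) * int (k v)"
    if "{v, w} \<in> E" for v w
  proof -
    have eq: "((c v mod int n) * int (k w) + (c w mod int n) * int (k v)) mod int n
        = (c v * int (k w) + c w * int (k v)) mod int n"
      by (intro mod_add_cong mod_mult_cong) simp_all
    then show ?thesis using assms(3)[OF that] by (simp only: dvd_eq_mod_eq_0 eq)
  qed
  then show ?thesis
    using assms(2) edge_endpoints[OF assms(1)]
    by (auto simp: carrier_H0_iff[OF assms(1,2)] reduce_mod_def)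
qed

section \<open>Critical cohomology as parity of cocycles\<close>

text \<open>The cocycle condition is linear, so that it holds for \<open>2 * b\<close> modulo \<open>2 ^ s\<close> if and only if it
  holds for \<open>b\<close> modulo \<open>2 ^ (s - 1)\<close>. Hence the critical cohomology is the image of the cocycles under
  reduction modulo 2.\<close>

lemma i_image_eq_even_cocycles:
  assumes "simple_graph V E" "s \<ge> 1"
  shows "i_image s V E k
    = {c \<in> carrier (H0 V E k (integer_mod_group (2 ^ s))). \<forall>v\<in>V. even (c v)}"
proof (intro equalityI subsetI)
  have p: "int (2 ^ s) = 2 * int (2 ^ (s - 1))"
    using assms(2) by (cases s) auto
  have half: "int (2 ^ s) dvd 2 * x * int l + 2 * y * int m \<longleftrightarrow> int (2 ^ (s - 1)) dvd x * int l + y * int m"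
    for x y l m
  proof -
    have "2 * x * int l + 2 * y * int m = 2 * (x * int l + y * int m)" by (simp add: algebra_simps)
    then show ?thesis unfolding p by (simp only: dvd_mult_cancel_left) simp
  qed
  have pos: "(2::nat) ^ t > 0" for t by simp
  note carrier = carrier_H0_iff[OF assms(1) pos]
  {
    fix c assume "c \<in> i_image s V E k"
    then obtain b where b: "b \<in> carrier (H0 V E k (integer_mod_group (2 ^ (s - 1))))"
      and c: "c = (\<lambda>v\<in>V. 2 * b v)"
      by (auto simp: i_image_def i_star_def)
    have "int (2 ^ s) dvd c v * int (k w) + c w * int (k v)" if "{v, w} \<in> E" for v w
      using b that edge_endpoints[OF assms(1) that] half[of "b v" "k w" "b w" "k v"]
      unfolding carrier c by simp
    moreover have "c \<in> V \<rightarrow>\<^sub>E {0..<int (2 ^ s)}"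
      using b unfolding carrier c p by (force simp: PiE_iff)
    ultimately have "c \<in> carrier (H0 V E k (integer_mod_group (2 ^ s)))"
      unfolding carrier by blast
    then show "c \<in> {c \<in> carrier (H0 V E k (integer_mod_group (2 ^ s))). \<forall>v\<in>V. even (c v)}"
      by (simp add: c)
  next
    fix c assume "c \<in> {c \<in> carrier (H0 V E k (integer_mod_group (2 ^ s))). \<forall>v\<in>V. even (c v)}"
    then have c: "c \<in> V \<rightarrow>\<^sub>E {0..<int (2 ^ s)}"
        "\<And>v w. {v, w} \<in> E \<Longrightarrow> int (2 ^ s) dvd c v * int (k w) + c w * int (k v)"
      and ev: "\<And>v. v \<in> V \<Longrightarrow> even (c v)"
      unfolding mem_Collect_eq carrier by blast+
    define b where "b = (\<lambda>v\<in>V. c v div 2)"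
    have cb: "c v = 2 * b v" if "v \<in> V" for v using ev[OF that] that by (simp add: b_def)
    have "int (2 ^ (s - 1)) dvd b v * int (k w) + b w * int (k v)" if "{v, w} \<in> E" for v w
      using c(2)[OF that] edge_endpoints[OF assms(1) that] half[of "b v" "k w" "b w" "k v"]
      by (simp add: cb)
    moreover have "b \<in> V \<rightarrow>\<^sub>E {0..<int (2 ^ (s - 1))}"
    proof (rule PiE_I)
      fix v assume "v \<in> V"
      then have "c v \<in> {0..<int (2 ^ s)}" using c(1) by (auto simp: PiE_iff)
      then show "b v \<in> {0..<int (2 ^ (s - 1))}" using cb[OF \<open>v \<in> V\<close>] p by simp
    qed (simp add: b_def)
    ultimately have "b \<in> carrier (H0 V E k (integer_mod_group (2 ^ (s - 1))))"
      unfolding carrier by blast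
    moreover have "c = i_star V b"
    proof
      fix v show "c v = i_star V b v"
        using c(1) cb by (cases "v \<in> V") (auto simp: i_star_def PiE_iff extensional_def)
    qed
    ultimately show "c \<in> i_image s V E k" by (simp add: i_image_def)
  }
qed

lemma (in group) generate_eq_carrier_of_two:
  assumes "carrier G = {\<one>, x}"
  shows "generate G {x} = carrier G"
proof
  show "generate G {x} \<subseteq> carrier G" using assms by (intro generate_incl) auto
  show "carrier G \<subseteq> generate G {x}" unfolding assms by (auto intro: generate.one generate.incl)
qed

locale reduced_color_scheme =
  fixes V :: "'v set" and E :: "'v set set" and k :: "'v \<Rightarrow> nat" and s :: nat
  assumes s_pos: "s \<ge> 1"
    and scheme: "negative_color_scheme V E k"
    and connected: "connected_graph V E"
    and reduced: "zmod_reduced (2 ^ s) E k"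
begin

abbreviation "H \<equiv> H0 V E k (integer_mod_group (2 ^ s))"

abbreviation "val v \<equiv> multiplicity 2 (k v)"

lemma graph: "simple_graph V E"
  using scheme by (simp add: negative_color_scheme_def)

lemma carrier_H_iff:
  "c \<in> carrier H \<longleftrightarrow>
    c \<in> V \<rightarrow>\<^sub>E {0..<2 ^ s} \<and> (\<forall>v w. {v, w} \<in> E \<longrightarrow> 2 ^ s dvd c v * int (k w) + c w * int (k v))"
  using carrier_H0_iff[OF graph, of "2 ^ s" c k] by simp

lemma weight_decompose:
  assumes "v \<in> V"
  obtains q where "int (k v) = 2 ^ val v * q" "odd q"
proof -
  have "k v \<noteq> 0" using scheme assms by (auto simp: negative_color_scheme_def)
  then obtain y where y: "k v = 2 ^ val v * y" "\<not> 2 dvd y"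
    using multiplicity_decompose'[of "k v" 2] by auto
  have "int (k v) = 2 ^ val v * int y" using y(1) by (metis of_nat_mult of_nat_numeral of_nat_power)
  then show ?thesis using that y(2) by auto
qed

lemma val_edge:
  assumes "{v, w} \<in> E"
  shows "multiplicity 2 (k v * k w) = val v + val w" "val v + val w < s"
proof -
  have pos: "k v \<noteq> 0" "k w \<noteq> 0"
    using scheme edge_endpoints[OF graph assms] by (auto simp: negative_color_scheme_def)
  then show *: "multiplicity 2 (k v * k w) = val v + val w"
    by (intro prime_elem_multiplicity_mult_distrib) auto
  have "\<not> 2 ^ s dvd k v * k w"
    using reduced assms by (auto simp: zmod_reduced_def cong_0_iff)
  then show "val v + val w < s"
    by (metis * multiplicity_dvd' not_le)
qed

text \<open>Along a path from \<open>r\<close>, the valuation of \<open>c u\<close> is \<open>val u - val r\<close>: on an edge \<open>{u, w}\<close> the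
  cocycle condition says \<open>c w * k u = - c u * k w\<close> modulo \<open>2 ^ s\<close>, and reducedness gives the right-hand
  side a valuation \<open>val u + val w - val r\<close> less than \<open>s\<close>, which the left-hand side must share. The
  powers of 2 are kept on both sides because \<open>val r \<le> val u\<close> is only a consequence.\<close>

lemma odd_cocycle_values:
  assumes c: "c \<in> carrier H" and r: "r \<in> V" "odd (c r)" and u: "u \<in> V"
  shows "\<exists>x. odd x \<and> c u * 2 ^ val r = 2 ^ val u * x"
proof -
  have "(r, u) \<in> {(x, y). {x, y} \<in> E}\<^sup>*"
    using connected r(1) u by (simp add: connected_graph_def)
  then show ?thesis
  proof (induction rule: rtrancl_induct)
    case base
    show ?case using r(2) by (intro exI[of _ "c r"]) simp
  next
    case (step u w)
    then have uw: "{u, w} \<in> E" by simp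
    obtain x where x: "odd x" "c u * 2 ^ val r = 2 ^ val u * x" using step.IH by blast
    obtain q where q: "int (k u) = 2 ^ val u * q" "odd q"
      using weight_decompose edge_endpoints(1)[OF graph uw] by blast
    obtain p where p: "int (k w) = 2 ^ val w * p" "odd p"
      using weight_decompose edge_endpoints(2)[OF graph uw] by blast
    obtain t where t: "c u * int (k w) + c w * int (k u) = 2 ^ s * t"
      using c uw by (meson carrier_H_iff dvdE)
    obtain j where j: "s = val u + val w + Suc j"
      using val_edge(2)[OF uw] less_iff_Suc_add by auto
    \<comment> \<open>The spare factor 2 in \<open>2 ^ s\<close> makes the next number odd.\<close>
    let ?y = "2 * (2 ^ j * 2 ^ val r * t) - p * x"
    have "2 ^ val u * (c w * 2 ^ val r * q) = c w * int (k u) * 2 ^ val r"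
      by (simp add: q(1))
    also have "\<dots> = (2 ^ s * t - c u * int (k w)) * 2 ^ val r"
      by (simp flip: t)
    also have "\<dots> = 2 ^ s * t * 2 ^ val r - (c u * 2 ^ val r) * int (k w)"
      by (simp add: algebra_simps)
    also have "\<dots> = 2 ^ val u * (2 ^ val w * ?y)"
      by (simp add: x(2) p(1) j power_add algebra_simps)
    finally have main: "c w * 2 ^ val r * q = 2 ^ val w * ?y" by simp
    have "coprime (2 ^ val w) q" using q(2) by simp
    then have "2 ^ val w dvd c w * 2 ^ val r"
      using main by (metis coprime_dvd_mult_left_iff dvd_triv_left)
    then obtain z where z: "c w * 2 ^ val r = 2 ^ val w * z" by blast
    then have "z * q = ?y" using main by simp
    moreover have "odd ?y" using p(2) x(1) by simp
    ultimately have "odd z" by (metis even_mult_iff)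
    then show ?case using z by blast
  qed
qed

text \<open>Hence all cocycles that are odd somewhere are odd at the same vertices, namely those of minimal
  valuation. This is why the critical cohomology has at most two elements.\<close>

lemma odd_cocycle_support:
  assumes c: "c \<in> carrier H" and r: "r \<in> V" "odd (c r)" and u: "u \<in> V"
  shows "odd (c u) \<longleftrightarrow> (\<forall>w\<in>V. val u \<le> val w)"
proof -
  have min: "val v \<le> val w" if vw: "v \<in> V" "odd (c v)" "w \<in> V" for v w
  proof (rule ccontr)
    assume "\<not> val v \<le> val w"
    then obtain j where j: "val v = val w + Suc j" using less_iff_Suc_add by (metis not_le add_Suc_right)
    obtain x where x: "odd x" "c w * 2 ^ val v = 2 ^ val w * x"
      using odd_cocycle_values[OF c vw] by blast
    from x(2) have "x = 2 * (c w * 2 ^ j)" by (simp add: j power_add)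
    then show False using x(1) by simp
  qed
  show ?thesis
  proof
    assume "\<forall>w\<in>V. val u \<le> val w"
    then have "val u = val r" using min[OF r u] r(1) by (simp add: order_antisym)
    then show "odd (c u)" using odd_cocycle_values[OF c r u] by auto
  qed (use min u in blast)
qed

text \<open>With an odd cocycle at hand, evenness needs to be tested at one vertex only. So the image of \<open>i\<close>
  becomes the kernel of a homomorphism onto the integers modulo 2.\<close>

lemma i_image_of_odd_cocycle:
  assumes "c \<in> carrier H" "r \<in> V" "odd (c r)"
  shows "i_image s V E k = {d \<in> carrier H. even (d r)}"
proof -
  have "even (d v)" if d: "d \<in> carrier H" "even (d r)" and v: "v \<in> V" for d v
  proof (rule ccontr)
    assume "odd (d v)"
    from odd_cocycle_support[OF d(1) v this assms(2)] odd_cocycle_support[OF assms assms(2)]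
    show False using d(2) assms(3) by simp
  qed
  then show ?thesis
    unfolding i_image_eq_even_cocycles[OF graph s_pos] using assms(2) by blast
qed

lemma parity_hom:
  assumes "r \<in> V"
  shows "group_hom H (integer_mod_group 2) (\<lambda>c. c r mod 2)"
proof -
  have "(\<lambda>c. c r mod 2) \<in> hom H (integer_mod_group 2)"
  proof (rule homI)
    fix c c'
    have "(c r + c' r) mod int (2 ^ s) mod 2 = (c r + c' r) mod 2"
      using s_pos by (intro mod_mod_cancel) (simp add: dvd_power)
    then show "(c \<otimes>\<^bsub>H\<^esub> c') r mod 2 = (c r mod 2) \<otimes>\<^bsub>integer_mod_group 2\<^esub> (c' r mod 2)"
      using assms by (simp add: mult_H0 mod_add_eq)
  qed (simp add: carrier_integer_mod_group)
  then show ?thesis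
    by (intro group_hom.intro group_hom_axioms.intro group_H0 graph) simp_all
qed

text \<open>Parity at \<open>r\<close> identifies the critical cohomology with the integers modulo 2, and \<open>c\<close> represents
  its only nontrivial element.\<close>

lemma odd_cocycle_orientation_class:
  assumes c: "c \<in> carrier H" and r: "r \<in> V" "odd (c r)"
  shows "orientation_class s V E k c"
proof -
  interpret group_hom H "integer_mod_group 2" "\<lambda>c. c r mod 2" by (rule parity_hom[OF r(1)])
  let ?I = "i_image s V E k"
  have I: "?I = kernel H (integer_mod_group 2) (\<lambda>c. c r mod 2)"
    unfolding i_image_of_odd_cocycle[OF assms] by (auto simp: kernel_def)
  have surj: "(\<lambda>c. c r mod 2) ` carrier H = carrier (integer_mod_group 2)"
  proof
    have "0 = \<one>\<^bsub>H\<^esub> r mod 2" "1 = c r mod 2"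
      using r by (simp_all add: H0_def C0_def odd_iff_mod_2_eq_one)
    then have "{0, 1} \<subseteq> (\<lambda>c. c r mod 2) ` carrier H" using c by blast
    moreover have "carrier (integer_mod_group 2) = {0, 1}"
      by (auto simp: carrier_integer_mod_group)
    ultimately show "carrier (integer_mod_group 2) \<subseteq> (\<lambda>c. c r mod 2) ` carrier H" by simp
  qed (auto simp: carrier_integer_mod_group)
  have oriented: "oriented s V E k"
    using FactGroup_iso[OF surj] connected by (simp add: oriented_def critical_cohomology_def I)
  interpret N: normal ?I H unfolding I by (rule normal_kernel)
  have Q: "group (critical_cohomology s V E k)"
    unfolding critical_cohomology_def by (rule N.factorgroup_is_group)
  have one: "\<one>\<^bsub>critical_cohomology s V E k\<^esub> = ?I"
    by (simp add: critical_cohomology_def FactGroup_def)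
  have "?I \<noteq> ?I #>\<^bsub>H\<^esub> c"
    using G.rcos_self[OF c N.subgroup_axioms] i_image_of_odd_cocycle[OF assms] r(2) by blast
  moreover have "?I #>\<^bsub>H\<^esub> c \<in> carrier (critical_cohomology s V E k)"
    using c by (auto simp: critical_cohomology_def FactGroup_def RCOSETS_def)
  moreover have "?I \<in> carrier (critical_cohomology s V E k)"
    using group.is_monoid[OF Q] monoid.one_closed one by metis
  moreover have "card (carrier (critical_cohomology s V E k)) = 2"
    using oriented iso_same_card[of "critical_cohomology s V E k" "integer_mod_group 2"]
    by (simp add: oriented_def carrier_integer_mod_group)
  ultimately have "carrier (critical_cohomology s V E k) = {?I, ?I #>\<^bsub>H\<^esub> c}"
    unfolding card_2_iff by auto
  then show ?thesis
    using oriented c group.generate_eq_carrier_of_two[OF Q] one by (simp add: orientation_class_def)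
qed

text \<open>Without odd values, all cocycles lie in the image of \<open>i\<close> and the critical cohomology is
  trivial.\<close>

lemma oriented_imp_odd_cocycle:
  assumes "oriented s V E k"
  obtains c r where "c \<in> carrier H" "r \<in> V" "odd (c r)"
proof -
  interpret group H by (rule group_H0[OF graph])
  have "\<exists>c\<in>carrier H. \<exists>r\<in>V. odd (c r)"
  proof (rule ccontr)
    assume "\<not> ?thesis"
    then have "i_image s V E k = carrier H"
      unfolding i_image_eq_even_cocycles[OF graph s_pos] by blast
    then have "carrier (critical_cohomology s V E k) = {carrier H}"
      using one_closed by (auto simp: critical_cohomology_def FactGroup_def RCOSETS_def
        coset_join2[OF _ subgroup_self])
    then have "card (carrier (integer_mod_group 2)) = 1"
      using assms iso_same_card[of "critical_cohomology s V E k" "integer_mod_group 2"]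
      by (simp add: oriented_def)
    then show False by (simp add: carrier_integer_mod_group)
  qed
  then show ?thesis using that by blast
qed

section \<open>Odd cocycles and bipartitionings\<close>

text \<open>For a cocycle that is odd at \<open>r\<close>, the odd parts \<open>x u\<close> of \<open>c u\<close> and \<open>q u\<close> of \<open>k u\<close> satisfy
  \<open>x u * q w + x w * q u = 0\<close> modulo \<open>2 ^ (s + val r - val u - val w)\<close>. When the exponent is at
  least 2, multiplication by \<open>q u * q w\<close>, whose squared factors are 1 modulo 4, shows that the odd numbers \<open>x u * q u\<close> and \<open>x w * q w\<close> are
  opposite modulo 4. Their signs modulo 4 then bipartition these edges.\<close>

lemma odd_cocycle_bipartite:
  assumes c: "c \<in> carrier H" and r: "r \<in> V" "odd (c r)" and "F \<subseteq> E"
    and F: "\<And>u w. {u, w} \<in> F \<Longrightarrow> val u + val w + 2 \<le> s + val r"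
  shows "bipartite V F"
proof -
  obtain x where x: "\<And>u. u \<in> V \<Longrightarrow> odd (x u)"
      "\<And>u. u \<in> V \<Longrightarrow> c u * 2 ^ val r = 2 ^ val u * x u"
    using odd_cocycle_values[OF c r] by metis
  obtain q where q: "\<And>u. u \<in> V \<Longrightarrow> int (k u) = 2 ^ val u * q u" "\<And>u. u \<in> V \<Longrightarrow> odd (q u)"
    using bchoice[of V "\<lambda>u q. int (k u) = 2 ^ val u * q \<and> odd q"] weight_decompose by metis
  \<comment> \<open>The odd number \<open>x u * q u\<close> is \<open>1\<close> or \<open>- 1\<close> modulo 4, and this is the sign of \<open>u\<close>.\<close>
  define \<alpha> where "\<alpha> u = (if x u * q u mod 4 = 1 then 1 else - 1 :: int)" for u
  have "\<alpha> u \<noteq> \<alpha> w" if uw: "{u, w} \<in> F" for u w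
  proof -
    have e: "{u, w} \<in> E" using uw assms(4) by blast
    note uV = edge_endpoints(1)[OF graph e] and wV = edge_endpoints(2)[OF graph e]
    obtain j where j: "s + val r = val u + val w + 2 + j"
      using F[OF uw] le_Suc_ex by blast
    obtain t where t: "c u * int (k w) + c w * int (k u) = 2 ^ s * t"
      using c e by (meson carrier_H_iff dvdE)
    have "2 ^ (val u + val w) * (x u * q w + x w * q u)
        = (c u * 2 ^ val r) * int (k w) + (c w * 2 ^ val r) * int (k u)"
      by (simp add: x(2) q(1) uV wV power_add algebra_simps)
    also have "\<dots> = (c u * int (k w) + c w * int (k u)) * 2 ^ val r"
      by (simp add: algebra_simps)
    also have "\<dots> = 2 ^ (s + val r) * t"
      unfolding t by (simp add: power_add)
    also have "\<dots> = 2 ^ (val u + val w) * (4 * (2 ^ j * t))"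
      unfolding j by (simp add: power_add)
    finally have sum: "x u * q w + x w * q u = 4 * (2 ^ j * t)" by simp
    have "4 dvd q u * q w * (x u * q w + x w * q u)" by (simp add: sum)
    moreover have "q u * q w * (x u * q w + x w * q u)
        = x u * q u * (q w)\<^sup>2 + x w * q w * (q u)\<^sup>2"
      by (simp add: power2_eq_square algebra_simps)
    ultimately have dvd: "4 dvd x u * q u * (q w)\<^sup>2 + x w * q w * (q u)\<^sup>2" by simp
    have sq: "z\<^sup>2 mod 4 = 1" if oddz: "odd z" for z :: int
    proof -
      obtain y where "z = 2 * y + 1" using oddz by (rule oddE)
      then have "z\<^sup>2 = 1 + 4 * (y\<^sup>2 + y)" by (simp add: power2_eq_square algebra_simps)
      then show ?thesis by presburger
    qed
    have "(x u * q u * (q w)\<^sup>2) mod 4 = (x u * q u) mod 4"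
      "(x w * q w * (q u)\<^sup>2) mod 4 = (x w * q w) mod 4"
      using sq q(2) uV wV by (metis mod_mult_right_eq mult.right_neutral)+
    then have "(x u * q u + x w * q w) mod 4 = 0"
      using dvd by (metis dvd_imp_mod_0 mod_add_eq)
    moreover have "odd (x u * q u)" "odd (x w * q w)" using x(1) q(2) uV wV by simp_all
    moreover have "(a + b) mod 4 = 0 \<Longrightarrow> odd a \<Longrightarrow> odd b \<Longrightarrow> a mod 4 = 1 \<longleftrightarrow> b mod 4 \<noteq> 1"
      for a b :: int
      by presburger
    ultimately have "x u * q u mod 4 = 1 \<longleftrightarrow> x w * q w mod 4 \<noteq> 1" by metis
    then show ?thesis by (auto simp: \<alpha>_def)
  qed
  then have "bipartitioning V F \<alpha>" by (auto simp: bipartitioning_def \<alpha>_def)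
  then show ?thesis by (auto simp: bipartite_def)
qed

lemma red_edges_subset: "red_edges t E k \<subseteq> E"
  by (auto simp: red_edges_def)

lemma red_edges_iff:
  assumes "{v, w} \<in> E"
  shows "{v, w} \<in> red_edges t E k \<longleftrightarrow> val v + val w < t"
proof
  show "val v + val w < t" if "{v, w} \<in> red_edges t E k"
    using that val_edge(1)[OF assms] by (fastforce simp: red_edges_def)
next
  assume lt: "val v + val w < t"
  have "\<not> t \<le> multiplicity 2 (k v' * k w')" if "{v, w} = {v', w'}" for v' w'
    using lt val_edge(1)[OF assms] that by (auto simp: doubleton_eq_iff mult.commute)
  then show "{v, w} \<in> red_edges t E k" using assms by (auto simp: red_edges_def)
qed

text \<open>\<open>odd_cocycle_bipartite\<close> asks for \<open>val u + val w + 2 \<le> s + val r\<close>. Reducedness gives \<open>val u + val w + 1 \<le> s\<close> on every edge. The missing unit comes from \<open>val r\<close> if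
  the greatest common divisor is even, and otherwise from deleting the edges of valuation \<open>s - 1\<close>.\<close>

lemma oriented_imp_bipartite:
  assumes "oriented s V E k"
  shows "bipartite V E \<or>
    (bipartite V (red_edges (s - 1) E k) \<and> multiplicity 2 (GCD v\<in>V. k v) = 0)"
proof -
  obtain c r where c: "c \<in> carrier H" "r \<in> V" "odd (c r)"
    using oriented_imp_odd_cocycle[OF assms] .
  show ?thesis
  proof (cases "multiplicity 2 (GCD v\<in>V. k v) = 0")
    case True
    have "bipartite V (red_edges (s - 1) E k)"
    proof (rule odd_cocycle_bipartite[OF c red_edges_subset])
      fix u w assume uw: "{u, w} \<in> red_edges (s - 1) E k"
      then have "val u + val w < s - 1" using red_edges_iff red_edges_subset by blast
      then show "val u + val w + 2 \<le> s + val r" by simp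
    qed
    then show ?thesis using True by blast
  next
    case False
    then have "2 dvd (GCD v\<in>V. k v)" by (metis not_dvd_imp_multiplicity_0)
    then have "2 dvd k r" using c(2) by (meson Gcd_dvd dvd_trans imageI)
    moreover have "k r \<noteq> 0" using scheme c(2) by (auto simp: negative_color_scheme_def)
    ultimately have r: "val r \<ge> 1"
      by (metis One_nat_def Suc_leI multiplicity_gt_zero_iff nat_dvd_1_iff_1 numeral_eq_one_iff semiring_norm(85))
    have "bipartite V E"
      by (rule odd_cocycle_bipartite[OF c order_refl]) (use val_edge(2) r in fastforce)
    then show ?thesis ..
  qed
qed

section \<open>The divided fundamental class\<close>

lemma gcd_weights_pos: "(GCD v\<in>V. k v) > 0"
proof -
  obtain v where "v \<in> V" using connected by (auto simp: connected_graph_def)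
  moreover have "k v > 0" using \<open>v \<in> V\<close> scheme by (simp add: negative_color_scheme_def)
  ultimately show ?thesis
    by (metis Gcd_dvd bot_nat_0.not_eq_extremum dvd_0_left_iff imageI)
qed

lemma divided_weight_odd:
  obtains r where "r \<in> V" "odd (k r div (GCD v\<in>V. k v))"
proof -
  let ?g = "GCD v\<in>V. k v"
  have "\<exists>r\<in>V. odd (k r div ?g)"
  proof (rule ccontr)
    assume "\<not> ?thesis"
    then have "2 * ?g dvd k v" if "v \<in> V" for v
      using that gcd_weights_pos
      by (metis Gcd_dvd dvd_div_mult_self imageI mult_dvd_mono dvd_refl)
    then have "2 * ?g dvd ?g" by (intro Gcd_greatest) blast
    then show False using gcd_weights_pos by (simp add: dvd_imp_le nat_dvd_not_less)
  qed
  then show ?thesis using that by blast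
qed

text \<open>The coboundary of the divided fundamental class on an edge \<open>{v, w}\<close> is
  \<open>(\<alpha> v + \<alpha> w) * k v * k w / GCD k\<close>. So only edges with equal signs impose a condition. The class is
  odd somewhere because the weights \<open>k v / GCD k\<close> have no common factor 2.\<close>

lemma divided_fundamental_class_orientation:
  assumes sign: "\<And>v. v \<in> V \<Longrightarrow> \<alpha> v \<in> {1, - 1}"
    and edge: "\<And>v w. {v, w} \<in> E \<Longrightarrow> \<alpha> v = \<alpha> w \<Longrightarrow>
      2 ^ s dvd 2 * (int (k v div (GCD u\<in>V. k u)) * int (k w))"
  shows "orientation_class s V E k (reduce_mod (2 ^ s) V (divided_fundamental_class V k \<alpha>))"
proof -
  let ?g = "GCD v\<in>V. k v"
  let ?c = "divided_fundamental_class V k \<alpha>"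
  have swap: "int (k w div ?g) * int (k v) = int (k v div ?g) * int (k w)" if "v \<in> V" "w \<in> V" for v w
  proof -
    have "k w div ?g * k v = k v div ?g * k w"
      using that by (metis Gcd_dvd div_mult_swap dvd_div_mult imageI mult.commute)
    then show ?thesis by (metis of_nat_mult)
  qed
  have "int (2 ^ s) dvd ?c v * int (k w) + ?c w * int (k v)" if e: "{v, w} \<in> E" for v w
  proof -
    have vw: "v \<in> V" "w \<in> V" using edge_endpoints[OF graph e] by auto
    have "?c v * int (k w) + ?c w * int (k v)
        = \<alpha> v * (int (k v div ?g) * int (k w)) + \<alpha> w * (int (k w div ?g) * int (k v))"
      using vw by (simp add: divided_fundamental_class_def)
    also have "\<dots> = (\<alpha> v + \<alpha> w) * (int (k v div ?g) * int (k w))"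
      by (simp only: swap[OF vw] distrib_right)
    finally have sum: "?c v * int (k w) + ?c w * int (k v)
        = (\<alpha> v + \<alpha> w) * (int (k v div ?g) * int (k w))" .
    show ?thesis
    proof (cases "\<alpha> v = \<alpha> w")
      case True
      have eq: "(\<alpha> v + \<alpha> w) * (int (k v div ?g) * int (k w))
          = \<alpha> v * (2 * (int (k v div ?g) * int (k w)))"
        using True by simp
      have "int (2 ^ s) dvd 2 * (int (k v div ?g) * int (k w))"
        using edge[OF e True] by (simp only: of_nat_power of_nat_numeral)
      then show ?thesis unfolding sum eq by (rule dvd_mult)
    next
      case False
      then have "\<alpha> v + \<alpha> w = 0" using sign[OF vw(1)] sign[OF vw(2)] by auto
      then show ?thesis unfolding sum by simp
    qed
  qed
  then have cocycle: "reduce_mod (2 ^ s) V ?c \<in> carrier H"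
    by (intro reduce_mod_in_carrier_H0[OF graph]) simp_all
  obtain r where r: "r \<in> V" "odd (k r div ?g)" by (rule divided_weight_odd)
  have "odd (?c r)"
    using r sign[OF r(1)] by (auto simp: divided_fundamental_class_def)
  moreover have "2 dvd int (2 ^ s)" using s_pos by simp
  then have "reduce_mod (2 ^ s) V ?c r mod 2 = ?c r mod 2"
    using r(1) by (simp only: reduce_mod_def restrict_apply' mod_mod_cancel)
  ultimately have "odd (reduce_mod (2 ^ s) V ?c r)" by presburger
  then show ?thesis by (rule odd_cocycle_orientation_class[OF cocycle r(1)])
qed

lemma bipartitioning_orientation:
  assumes "bipartitioning V E \<alpha>"
  shows "orientation_class s V E k (reduce_mod (2 ^ s) V (divided_fundamental_class V k \<alpha>))"
  by (rule divided_fundamental_class_orientation) (use assms in \<open>auto simp: bipartitioning_def\<close>)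

text \<open>The deleted edges have \<open>k v * k w\<close> divisible by \<open>2 ^ (s - 1)\<close>, which an odd greatest common
  divisor does not spoil; the factor 2 from equal signs makes up the missing power.\<close>

lemma red_bipartitioning_orientation:
  assumes \<alpha>: "bipartitioning V (red_edges (s - 1) E k) \<alpha>"
    and g: "multiplicity 2 (GCD v\<in>V. k v) = 0"
  shows "orientation_class s V E k (reduce_mod (2 ^ s) V (divided_fundamental_class V k \<alpha>))"
proof (rule divided_fundamental_class_orientation)
  show "\<alpha> v \<in> {1, - 1}" if "v \<in> V" for v using \<alpha> that by (simp add: bipartitioning_def)
next
  let ?g = "GCD v\<in>V. k v"
  fix v w assume e: "{v, w} \<in> E" and eq: "\<alpha> v = \<alpha> w"
  have v: "v \<in> V" using edge_endpoints[OF graph e] by simp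
  have "?g \<noteq> 0" using gcd_weights_pos by (rule gr_implies_not_zero)
  then have odd_g: "odd ?g"
    by (rule multiplicity_eq_zero_iff[THEN iffD1, OF _ _ g]) simp
  have "{v, w} \<notin> red_edges (s - 1) E k" using \<alpha> eq by (auto simp: bipartitioning_def)
  then have "s - 1 \<le> multiplicity 2 (k v * k w)"
    using red_edges_iff[OF e] val_edge(1)[OF e] by simp
  then have "2 ^ (s - 1) dvd k v * k w" by (rule multiplicity_dvd')
  also have "k v * k w = ?g * (k v div ?g * k w)"
    using v by (simp add: Gcd_dvd mult.assoc[symmetric])
  finally have "2 ^ (s - 1) dvd k v div ?g * k w"
    using odd_g by (simp add: coprime_dvd_mult_right_iff)
  then have "2 * 2 ^ (s - 1) dvd 2 * (k v div ?g * k w)" by (rule mult_dvd_mono[OF dvd_refl])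
  moreover have "2 * 2 ^ (s - 1) = (2 ^ s :: nat)" using s_pos by (cases s) auto
  ultimately have "2 ^ s dvd 2 * (k v div ?g * k w)" by (simp only:)
  then have "int (2 ^ s) dvd int (2 * (k v div ?g * k w))" by (simp only: of_nat_dvd_iff)
  then show "2 ^ s dvd 2 * (int (k v div ?g) * int (k w))" by simp
qed

end

theorem lemma18:
  fixes V :: "'v set" and E :: "'v set set" and k :: "'v \<Rightarrow> nat" and s :: nat
  assumes "s \<ge> 1"
    and "negative_color_scheme V E k"
    and "connected_graph V E"
    and "zmod_reduced (2 ^ s) E k"
  shows "(oriented s V E k \<longrightarrow>
            bipartite V E \<or>
            (\<not> bipartite V E \<and> bipartite V (red_edges (s - 1) E k) \<and>
             multiplicity 2 (GCD v\<in>V. k v) = 0)) \<and>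
         (\<forall>\<alpha>. bipartitioning V E \<alpha> \<longrightarrow>
            orientation_class s V E k (reduce_mod (2 ^ s) V (divided_fundamental_class V k \<alpha>))) \<and>
         (bipartite V (red_edges (s - 1) E k) \<and> multiplicity 2 (GCD v\<in>V. k v) = 0 \<longrightarrow>
            (\<forall>\<alpha>. bipartitioning V (red_edges (s - 1) E k) \<alpha> \<longrightarrow>
               orientation_class s V E k
                 (reduce_mod (2 ^ s) V (divided_fundamental_class V k \<alpha>))))"
proof -
  interpret reduced_color_scheme V E k s
    using assms by unfold_locales
  show ?thesis
    using oriented_imp_bipartite bipartitioning_orientation red_bipartitioning_orientation by blast
qed

end
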